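(* Let $a\ge 0$ and $f(x)=ax^2$. Let $\{X_n^\varepsilon\}_{n\ge 0}$ be the process defined by $X_0^\varepsilon=0$ and $X_{n+1}^\varepsilon=f(X_n^\varepsilon)+\varepsilon\xi_{n+1}$, and let $\tau=\min\{n\ge 1:|X_n^\varepsilon|\ge 1\}$. If $0\le a\le 0.5$, then $$\limsup_{\varepsilon\to 0}\varepsilon^2\log E\tau\le\frac12.$$ If $a\ge 0.5$, then $$\limsup_{\varepsilon\to 0}\varepsilon^2\log E\tau\le\frac12\left(\frac1a-\frac{1}{4a^2}\right).$$
   Context: Here $\varepsilon>0$ is a small parameter tending to $0$ and $\{\xi_n\}_{n\ge 1}$ is an i.i.d. sequence of standard normal random variables. *)

theory Defs
  imports "HOL-Probability.Probability"
begin

primrec proc :: "(real \<Rightarrow> real) \<Rightarrow> real \<Rightarrow> (nat \<Rightarrow> 'w \<Rightarrow> real) \<Rightarrow> nat \<Rightarrow> 'w \<Rightarrow> real" where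
  "proc f \<epsilon> \<xi> 0 \<omega> = 0"
| "proc f \<epsilon> \<xi> (Suc n) \<omega> = f (proc f \<epsilon> \<xi> n \<omega>) + \<epsilon> * \<xi> (Suc n) \<omega>"

(* The infimum of the empty set in enat is \<infinity>, so \<tau> = \<infinity> on paths that never leave (-1, 1). *)
definition exit_time :: "(nat \<Rightarrow> 'w \<Rightarrow> real) \<Rightarrow> 'w \<Rightarrow> enat" where
  "exit_time X \<omega> = Inf {enat n | n. n \<ge> 1 \<and> \<bar>X n \<omega>\<bar> \<ge> 1}"

(* A nonnegative integral, so that an infinite mean is \<infinity> and not 0 as for the Bochner integral. *)
definition mean_exit_time :: "'w measure \<Rightarrow> (nat \<Rightarrow> 'w \<Rightarrow> real) \<Rightarrow> ennreal" where
  "mean_exit_time M X = (\<integral>\<^sup>+ \<omega>. ennreal_of_enat (exit_time X \<omega>) \<partial>M)"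

definition ln_ennreal :: "ennreal \<Rightarrow> ereal" where
  "ln_ennreal x = (if x = 0 then -\<infinity> else if x = \<infinity> then \<infinity> else ereal (ln (enn2real x)))"

end

(* Since f >= 0, whatever the current state, two consecutive noise terms with
   \<epsilon> \<xi> \<ge> c and then \<epsilon> \<xi> \<ge> d push the process to at least a c^2 + d.  If that is at least 1, each of
   the disjoint blocks of two steps produces an exit with probability at least
   p = P(\<epsilon> \<xi> \<ge> c) P(\<epsilon> \<xi> \<ge> d), independently of the others, so E \<tau> \<le> 2/p, which is
   exp ((c^2 + d^2) / (2 \<epsilon>^2)) to leading order.  Minimising c^2 + d^2 subject to a c^2 + d = 1 gives
   c = 0, d = 1 for a \<le> 1/2 and c^2 = 1/a - 1/(2 a^2), d = 1/(2 a) for a \<ge> 1/2. *)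
theory Submission
  imports Defs
begin

section \<open>Exit times along a single path\<close>

lemma exit_time_le:
  assumes "n \<ge> 1" "\<bar>X n \<omega>\<bar> \<ge> 1"
  shows "exit_time X \<omega> \<le> enat n"
  unfolding exit_time_def using assms by (intro Inf_lower) auto

text \<open>The state at time \<open>n\<close> enters only through \<open>f \<ge> 0\<close>, so the
  two noise conditions suffice from anywhere; \<open>c \<ge> 0\<close> lets squaring preserve the
  lower bound.\<close>

lemma proc_two_steps_ge:
  assumes "a \<ge> 0" "\<epsilon> > 0" "c \<ge> 0" "a * c\<^sup>2 + d \<ge> 1"
    and "\<xi> (Suc n) \<omega> \<ge> c / \<epsilon>" "\<xi> (Suc (Suc n)) \<omega> \<ge> d / \<epsilon>"
  shows "proc (\<lambda>x. a * x\<^sup>2) \<epsilon> \<xi> (Suc (Suc n)) \<omega> \<ge> 1"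
proof -
  have "c \<le> \<epsilon> * \<xi> (Suc n) \<omega>" "d \<le> \<epsilon> * \<xi> (Suc (Suc n)) \<omega>"
    using assms by (simp_all add: field_simps)
  moreover have "c \<le> proc (\<lambda>x. a * x\<^sup>2) \<epsilon> \<xi> (Suc n) \<omega>"
    using calculation(1) \<open>a \<ge> 0\<close> by (simp add: add_increasing)
  then have "a * c\<^sup>2 \<le> a * (proc (\<lambda>x. a * x\<^sup>2) \<epsilon> \<xi> (Suc n) \<omega>)\<^sup>2"
    using assms by (intro mult_left_mono power_mono) auto
  ultimately show ?thesis using assms(4) by simp
qed

text \<open>The summand with index \<open>k\<close> is \<open>m\<close> as long as blocks
  \<open>0..<k\<close> have all failed, so the series is \<open>m\<close> times the number of blocks
  up to and including the first success. Without any success it diverges, since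
  \<open>m > 0\<close>, which covers \<open>t = \<infinity>\<close>.\<close>

lemma ennreal_of_enat_le_suminf_indicator:
  fixes t :: enat
  assumes "\<And>k. P k \<Longrightarrow> t \<le> enat (m * Suc k)" "m > 0"
  shows "ennreal_of_enat t \<le> (\<Sum>k. of_nat m * (if \<forall>j<k. \<not> P j then 1 else 0))"
proof (cases "\<exists>k. P k")
  case True
  define K where "K = (LEAST k. P k)"
  have "P K" using True unfolding K_def by (metis LeastI)
  have no: "\<not> P j" if "j < K" for j using not_less_Least that unfolding K_def by blast
  have "ennreal_of_enat t \<le> ennreal_of_enat (enat (m * Suc K))"
    using assms(1)[OF \<open>P K\<close>] by (subst ennreal_of_enat_le_iff)
  also have "\<dots> = (\<Sum>k<Suc K. of_nat m)"
    by (simp add: mult.commute distrib_left)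
  also have "\<dots> = (\<Sum>k<Suc K. of_nat m * (if \<forall>j<k. \<not> P j then 1 else 0))"
    using no by (intro sum.cong) auto
  also have "\<dots> \<le> (\<Sum>k. of_nat m * (if \<forall>j<k. \<not> P j then 1 else 0))"
    by (intro sum_le_suminf) auto
  finally show ?thesis .
next
  case False
  have "(\<Sum>k::nat. (of_nat m :: ennreal)) = \<infinity>"
    using nn_integral_count_space_nat[of "\<lambda>_. of_nat m"] \<open>m > 0\<close>
    by (simp add: ennreal_mult_eq_top_iff)
  then show ?thesis using False by simp
qed

section \<open>Independent blocks and the geometric bound on the mean\<close>

text \<open>Independence is used twice: between blocks, because disjoint groups of independent
  variables form independent random vectors, and inside a block, where the joint success probability
  splits into two tail probabilities.\<close>

lemma (in prob_space) indep_block_events: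
  assumes ind: "indep_vars (\<lambda>_. borel) \<xi> {1..}"
    and j: "finite J"
  shows "prob {\<omega>\<in>space M. \<forall>j\<in>J. \<not> (s \<le> \<xi> (Suc (2 * j)) \<omega> \<and> t \<le> \<xi> (Suc (Suc (2 * j))) \<omega>)}
    = (\<Prod>j\<in>J. 1 - prob {\<omega>\<in>space M. s \<le> \<xi> (Suc (2 * j)) \<omega>}
                  * prob {\<omega>\<in>space M. t \<le> (\<xi> (Suc (Suc (2 * j))) \<omega> :: real)})"
\<comment> \<open>An intersection over the empty index set would be the whole type and not
  \<open>space M\<close>. The empty case does occur later, as \<open>k = 0\<close> in the geometric
  bound.\<close>
proof (cases "J = {}")
  case True
  then show ?thesis by (simp add: prob_space)
next
  case False
  define K where "K j = {Suc (2 * j), Suc (Suc (2 * j))}" for j :: nat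
  define Y where "Y j \<omega> = restrict (\<lambda>i. \<xi> i \<omega>) (K j)" for j \<omega>
  \<comment> \<open>Failure of block \<open>j\<close>, written as a measurable set of pairs of
    values, so that the event is the preimage of \<open>B j\<close> under the random vector
    \<open>Y j\<close>.\<close>
  define B where "B j = {v \<in> space (PiM (K j) (\<lambda>_. borel :: real measure)).
      \<not> (s \<le> v (Suc (2 * j)) \<and> t \<le> v (Suc (Suc (2 * j))))}" for j
  have rv [measurable]: "\<xi> i \<in> borel_measurable M" if "i \<ge> 1" for i
    using ind that by (auto simp: indep_vars_def)
  have "disjoint_family_on K J"
    by (auto simp: disjoint_family_on_def K_def)
  then have Y: "indep_vars (\<lambda>j. PiM (K j) (\<lambda>_. borel)) Y J"
    unfolding Y_def by (intro indep_vars_restrict[OF ind]) (auto simp: K_def[abs_def])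
  have B: "B j \<in> sets (PiM (K j) (\<lambda>_. borel))" for j
  proof -
    have [measurable]: "(\<lambda>v. v i) \<in> borel_measurable (PiM (K j) (\<lambda>_. borel :: real measure))"
      if "i \<in> K j" for i
      using that by (rule measurable_component_singleton)
    have [measurable]: "Suc (2 * j) \<in> K j" "Suc (Suc (2 * j)) \<in> K j" by (auto simp: K_def)
    show ?thesis unfolding B_def by measurable
  qed
  have vim: "Y j -` B j \<inter> space M =
      {\<omega>\<in>space M. \<not> (s \<le> \<xi> (Suc (2 * j)) \<omega> \<and> t \<le> \<xi> (Suc (Suc (2 * j))) \<omega>)}" for j
    by (auto simp: Y_def B_def K_def space_PiM)
  have "{\<omega>\<in>space M. \<forall>j\<in>J. \<not> (s \<le> \<xi> (Suc (2 * j)) \<omega> \<and> t \<le> \<xi> (Suc (Suc (2 * j))) \<omega>)}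
      = (\<Inter>j\<in>J. Y j -` B j \<inter> space M)"
    unfolding vim using False by auto
  also have "prob \<dots> = (\<Prod>j\<in>J. prob (Y j -` B j \<inter> space M))"
    using B by (intro indep_varsD[OF Y False j]) auto
  also have "\<dots> = (\<Prod>j\<in>J. 1 - prob {\<omega>\<in>space M. s \<le> \<xi> (Suc (2 * j)) \<omega>}
                  * prob {\<omega>\<in>space M. t \<le> \<xi> (Suc (Suc (2 * j))) \<omega>})"
  proof (rule prod.cong[OF refl])
    fix j
    have [measurable]: "\<xi> (Suc (2 * j)) \<in> borel_measurable M"
        "\<xi> (Suc (Suc (2 * j))) \<in> borel_measurable M"
      by (auto intro!: rv)
    have "indep_vars (\<lambda>_. borel) \<xi> (K j)"
      using ind by (rule indep_vars_subset) (auto simp: K_def)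
    \<comment> \<open>The conditional assigns the half-line \<open>{s..}\<close> to the first index
      of the block and \<open>{t..}\<close> to the second.\<close>
    from indep_varsD_finite[OF this, of "\<lambda>i. if i = Suc (2 * j) then {s..} else {t..}"]
    have "prob (\<Inter>i\<in>K j. \<xi> i -` (if i = Suc (2 * j) then {s..} else {t..}) \<inter> space M) =
      (\<Prod>i\<in>K j. prob (\<xi> i -` (if i = Suc (2 * j) then {s..} else {t..}) \<inter> space M))"
      by (auto simp: K_def)
    then have "prob ((\<xi> (Suc (2 * j)) -` {s..} \<inter> space M) \<inter> (\<xi> (Suc (Suc (2 * j))) -` {t..} \<inter> space M))
      = prob (\<xi> (Suc (2 * j)) -` {s..} \<inter> space M) * prob (\<xi> (Suc (Suc (2 * j))) -` {t..} \<inter> space M)"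
      by (simp add: K_def)
    moreover have "(\<xi> (Suc (2 * j)) -` {s..} \<inter> space M) \<inter> (\<xi> (Suc (Suc (2 * j))) -` {t..} \<inter> space M) =
       {\<omega>\<in>space M. s \<le> \<xi> (Suc (2 * j)) \<omega> \<and> t \<le> \<xi> (Suc (Suc (2 * j))) \<omega>}"
       "\<xi> (Suc (2 * j)) -` {s..} \<inter> space M = {\<omega>\<in>space M. s \<le> \<xi> (Suc (2 * j)) \<omega>}"
       "\<xi> (Suc (Suc (2 * j))) -` {t..} \<inter> space M = {\<omega>\<in>space M. t \<le> \<xi> (Suc (Suc (2 * j))) \<omega>}"
      by auto
    ultimately have "prob {\<omega>\<in>space M. s \<le> \<xi> (Suc (2 * j)) \<omega> \<and> t \<le> \<xi> (Suc (Suc (2 * j))) \<omega>}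
      = prob {\<omega>\<in>space M. s \<le> \<xi> (Suc (2 * j)) \<omega>} * prob {\<omega>\<in>space M. t \<le> \<xi> (Suc (Suc (2 * j))) \<omega>}"
      by metis
    moreover have "prob {\<omega>\<in>space M. \<not> (s \<le> \<xi> (Suc (2 * j)) \<omega> \<and> t \<le> \<xi> (Suc (Suc (2 * j))) \<omega>)}
      = 1 - prob {\<omega>\<in>space M. s \<le> \<xi> (Suc (2 * j)) \<omega> \<and> t \<le> \<xi> (Suc (Suc (2 * j))) \<omega>}"
      by (rule prob_neg) measurable
    ultimately show "prob (Y j -` B j \<inter> space M) = 1 - prob {\<omega>\<in>space M. s \<le> \<xi> (Suc (2 * j)) \<omega>}
                  * prob {\<omega>\<in>space M. t \<le> \<xi> (Suc (Suc (2 * j))) \<omega>}"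
      unfolding vim by simp
  qed
  finally show ?thesis .
qed

text \<open>The density decreases on \<open>{s..s+1}\<close> because \<open>s \<ge> 0\<close>, so
  its integral over this unit interval is at least its value at the right end. The shift by 1 is
  harmless: for \<open>s = c / \<epsilon>\<close> it becomes a shift of \<open>c\<close> by
  \<open>\<epsilon>\<close> after scaling.\<close>

lemma (in prob_space) std_normal_tail_ge:
  assumes "distributed M lborel X std_normal_density" "s \<ge> 0"
  shows "prob {\<omega>\<in>space M. s \<le> X \<omega>} \<ge> std_normal_density (s + 1)"
proof -
  have [measurable]: "X \<in> borel_measurable M"
    using distributed_measurable[OF assms(1)] by simp
  have "ennreal (std_normal_density (s + 1)) =
      (\<integral>\<^sup>+x. ennreal (std_normal_density (s + 1)) * indicator {s..s+1} x \<partial>lborel)"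
    by (simp add: nn_integral_cmult_indicator)
  also have "\<dots> \<le> (\<integral>\<^sup>+x. ennreal (std_normal_density x) * indicator {s..} x \<partial>lborel)"
  proof (intro nn_integral_mono)
    fix x :: real
    have "std_normal_density (s + 1) \<le> std_normal_density x" if "s \<le> x" "x \<le> s + 1"
    proof -
      have "x\<^sup>2 \<le> (s + 1)\<^sup>2" using that assms(2) by (intro power_mono) auto
      then show ?thesis by (simp add: std_normal_density_def divide_right_mono)
    qed
    then show "ennreal (std_normal_density (s + 1)) * indicator {s..s+1} x
        \<le> ennreal (std_normal_density x) * indicator {s..} x"
      by (auto simp: indicator_def intro!: ennreal_leI)
  qed
  also have "\<dots> = emeasure M (X -` {s..} \<inter> space M)"
    using distributed_emeasure[OF assms(1), of "{s..}"] by simp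
  also have "X -` {s..} \<inter> space M = {\<omega>\<in>space M. s \<le> X \<omega>}" by auto
  finally show ?thesis by (simp add: emeasure_eq_measure)
qed

text \<open>With \<open>q\<close> the product of the two densities, all of the first
  \<open>k\<close> blocks fail with probability at most \<open>(1 - q) ^ k\<close>; summing the
  block length 2 against this geometric series gives \<open>2 / q\<close>.\<close>

lemma (in prob_space) mean_exit_time_le:
  fixes \<xi> :: "nat \<Rightarrow> 'a \<Rightarrow> real"
  assumes ind: "indep_vars (\<lambda>_. borel) \<xi> {1..}"
    and dist: "\<And>n. n \<ge> 1 \<Longrightarrow> distributed M lborel (\<xi> n) std_normal_density"
    and a: "a \<ge> 0" "\<epsilon> > 0" "c \<ge> 0" "d \<ge> 0" "a * c\<^sup>2 + d \<ge> 1"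
  shows "mean_exit_time M (proc (\<lambda>x. a * x\<^sup>2) \<epsilon> \<xi>)
    \<le> ennreal (2 / (std_normal_density (c / \<epsilon> + 1) * std_normal_density (d / \<epsilon> + 1)))"
proof -
  define q where "q = std_normal_density (c / \<epsilon> + 1) * std_normal_density (d / \<epsilon> + 1)"
  define A where "A k \<omega> \<longleftrightarrow> c / \<epsilon> \<le> \<xi> (Suc (2 * k)) \<omega> \<and> d / \<epsilon> \<le> \<xi> (Suc (Suc (2 * k))) \<omega>" for k \<omega>
  have "q > 0" by (simp add: q_def normal_density_pos)
  have p1: "std_normal_density (c / \<epsilon> + 1) \<le> prob {\<omega>\<in>space M. c / \<epsilon> \<le> \<xi> (Suc (2 * j)) \<omega>}"
   and p2: "std_normal_density (d / \<epsilon> + 1) \<le> prob {\<omega>\<in>space M. d / \<epsilon> \<le> \<xi> (Suc (Suc (2 * j))) \<omega>}" for j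
    using a by (auto intro!: std_normal_tail_ge dist)
  have "q \<le> prob {\<omega>\<in>space M. c / \<epsilon> \<le> \<xi> (Suc (2 * j)) \<omega>}
      * prob {\<omega>\<in>space M. d / \<epsilon> \<le> \<xi> (Suc (Suc (2 * j))) \<omega>}" for j
    unfolding q_def by (intro mult_mono p1 p2) auto
  \<comment> \<open>This gives the nonnegativity of the factors, without which the product could not
    be bounded factor by factor.\<close>
  moreover have "prob E * prob F \<le> 1" for E F by (intro mult_le_one) auto
  ultimately have fac: "0 \<le> 1 - prob {\<omega>\<in>space M. c / \<epsilon> \<le> \<xi> (Suc (2 * j)) \<omega>}
      * prob {\<omega>\<in>space M. d / \<epsilon> \<le> \<xi> (Suc (Suc (2 * j))) \<omega>}"
    "1 - prob {\<omega>\<in>space M. c / \<epsilon> \<le> \<xi> (Suc (2 * j)) \<omega>}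
      * prob {\<omega>\<in>space M. d / \<epsilon> \<le> \<xi> (Suc (Suc (2 * j))) \<omega>} \<le> 1 - q" for j
    by (auto simp: algebra_simps)
  have "q \<le> 1" using fac[of 0] by linarith
  have [measurable]: "\<xi> (Suc i) \<in> borel_measurable M" for i
    using ind by (auto simp: indep_vars_def)
  have [measurable]: "Measurable.pred M (A j)" for j
    unfolding A_def by measurable
  have pB: "prob {\<omega>\<in>space M. \<forall>j<k. \<not> A j \<omega>} \<le> (1 - q) ^ k" for k
  proof -
    have "prob {\<omega>\<in>space M. \<forall>j<k. \<not> A j \<omega>} = prob {\<omega>\<in>space M. \<forall>j\<in>{..<k}. \<not> A j \<omega>}"
      by (simp add: Ball_def)
    also have "\<dots> \<le> (\<Prod>j\<in>{..<k}. 1 - q)"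
      unfolding A_def indep_block_events[OF ind finite_lessThan] by (intro prod_mono conjI fac)
    finally show ?thesis by simp
  qed
  have "mean_exit_time M (proc (\<lambda>x. a * x\<^sup>2) \<epsilon> \<xi>)
     \<le> (\<integral>\<^sup>+\<omega>. (\<Sum>k. of_nat 2 * (if \<forall>j<k. \<not> A j \<omega> then 1 else 0)) \<partial>M)"
    unfolding mean_exit_time_def
  proof (intro nn_integral_mono ennreal_of_enat_le_suminf_indicator)
    fix \<omega> k assume "A k \<omega>"
    then have "proc (\<lambda>x. a * x\<^sup>2) \<epsilon> \<xi> (Suc (Suc (2 * k))) \<omega> \<ge> 1"
      using a by (intro proc_two_steps_ge) (auto simp: A_def)
    \<comment> \<open>Block \<open>k\<close>, counted from 0, ends at time
      \<open>2 * k + 2 = 2 * Suc k\<close>. Unfolding \<open>proc.simps\<close> would destroy the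
      match with the bound just obtained.\<close>
    then show "exit_time (proc (\<lambda>x. a * x\<^sup>2) \<epsilon> \<xi>) \<omega> \<le> enat (2 * Suc k)"
      by (intro exit_time_le) (auto simp del: proc.simps)
  qed simp
  also have "\<dots> = (\<Sum>k. \<integral>\<^sup>+\<omega>. of_nat 2 * (if \<forall>j<k. \<not> A j \<omega> then 1 else 0) \<partial>M)"
    by (intro nn_integral_suminf) measurable
  also have "\<dots> = (\<Sum>k. 2 * emeasure M {\<omega>\<in>space M. \<forall>j<k. \<not> A j \<omega>})"
  proof (intro suminf_cong)
    fix k
    have "(\<integral>\<^sup>+\<omega>. of_nat 2 * (if \<forall>j<k. \<not> A j \<omega> then 1 else 0) \<partial>M)
        = (\<integral>\<^sup>+\<omega>. 2 * indicator {\<omega>\<in>space M. \<forall>j<k. \<not> A j \<omega>} \<omega> \<partial>M)"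
      by (intro nn_integral_cong) (simp add: indicator_def of_bool_def)
    also have "\<dots> = 2 * emeasure M {\<omega>\<in>space M. \<forall>j<k. \<not> A j \<omega>}"
      by (intro nn_integral_cmult_indicator) measurable
    finally show "(\<integral>\<^sup>+\<omega>. of_nat 2 * (if \<forall>j<k. \<not> A j \<omega> then 1 else 0) \<partial>M)
        = 2 * emeasure M {\<omega>\<in>space M. \<forall>j<k. \<not> A j \<omega>}" .
  qed
  also have "\<dots> \<le> (\<Sum>k. ennreal (2 * (1 - q) ^ k))"
  proof (intro suminf_le)
    fix k
    have "2 * emeasure M {\<omega>\<in>space M. \<forall>j<k. \<not> A j \<omega>} = ennreal (2 * prob {\<omega>\<in>space M. \<forall>j<k. \<not> A j \<omega>})"
      by (simp add: emeasure_eq_measure ennreal_mult)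
    also have "\<dots> \<le> ennreal (2 * (1 - q) ^ k)"
      using pB by (intro ennreal_leI) simp
    finally show "2 * emeasure M {\<omega>\<in>space M. \<forall>j<k. \<not> A j \<omega>} \<le> ennreal (2 * (1 - q) ^ k)" .
  qed auto
  also have "\<dots> = ennreal (2 / q)"
  proof (rule suminf_ennreal_eq)
    have "(\<lambda>k. (1 - q) ^ k) sums (1 / (1 - (1 - q)))"
      using \<open>q > 0\<close> \<open>q \<le> 1\<close> by (intro geometric_sums) auto
    from sums_mult[OF this, of 2] show "(\<lambda>k. 2 * (1 - q) ^ k) sums (2 / q)" by simp
  qed (use \<open>q \<le> 1\<close> in auto)
  finally show ?thesis unfolding q_def .
qed

section \<open>Logarithmic asymptotics as \<open>\<epsilon>\<close> tends to 0\<close>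

lemma ln_ennreal_le:
  assumes "x \<le> ennreal r" "r > 0"
  shows "ln_ennreal x \<le> ereal (ln r)"
proof (cases "x = 0")
  case False
  have "x < \<infinity>" using assms(1) by (simp add: order_le_less_trans)
  moreover have "enn2real x > 0"
    using False calculation by (simp add: enn2real_positive_iff zero_less_iff_neq_zero less_top)
  moreover have "enn2real x \<le> r" using assms by (intro enn2real_leI) auto
  ultimately show ?thesis using False by (auto simp: ln_ennreal_def)
qed (simp add: ln_ennreal_def)

lemma (in prob_space) Limsup_ln_mean_exit_time_le:
  fixes \<xi> :: "nat \<Rightarrow> 'a \<Rightarrow> real"
  assumes ind: "indep_vars (\<lambda>_. borel) \<xi> {1..}"
    and dist: "\<And>n. n \<ge> 1 \<Longrightarrow> distributed M lborel (\<xi> n) std_normal_density"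
    and a: "a \<ge> 0" "c \<ge> 0" "d \<ge> 0" "a * c\<^sup>2 + d \<ge> 1"
  shows "Limsup (at_right (0::real))
      (\<lambda>\<epsilon>. ereal (\<epsilon>\<^sup>2) * ln_ennreal (mean_exit_time M (proc (\<lambda>x. a * x\<^sup>2) \<epsilon> \<xi>)))
    \<le> ereal ((c\<^sup>2 + d\<^sup>2) / 2)"
proof -
  \<comment> \<open>This is exactly \<open>\<epsilon>\<^sup>2 * ln\<close> of the bound
    \<open>2 / q\<close>: the constant \<open>4 * pi\<close> is 2 times the square of the
    normalisation \<open>sqrt (2 * pi)\<close>. Being polynomial in \<open>\<epsilon>\<close>, it
    converges to its value at 0.\<close>
  define g where "g \<epsilon> = \<epsilon>\<^sup>2 * ln (4 * pi) + ((c + \<epsilon>)\<^sup>2 + (d + \<epsilon>)\<^sup>2) / 2" for \<epsilon>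
  have "ereal (\<epsilon>\<^sup>2) * ln_ennreal (mean_exit_time M (proc (\<lambda>x. a * x\<^sup>2) \<epsilon> \<xi>)) \<le> ereal (g \<epsilon>)"
    if "\<epsilon> > 0" for \<epsilon>
  proof -
    define r where "r = 2 / (std_normal_density (c / \<epsilon> + 1) * std_normal_density (d / \<epsilon> + 1))"
    have "2 / (1 / s * exp (- x) * (1 / s * exp (- y))) = 2 * s\<^sup>2 * exp (x + y)" for s x y :: real
      unfolding exp_minus exp_add power2_eq_square by (simp add: field_simps)
    from this[of "sqrt (2 * pi)"]
    have r: "r = 4 * pi * exp ((c / \<epsilon> + 1)\<^sup>2 / 2 + (d / \<epsilon> + 1)\<^sup>2 / 2)"
      unfolding r_def std_normal_density_def minus_divide_left[symmetric] by simp
    have "\<epsilon>\<^sup>2 * ln (4 * pi * exp (u\<^sup>2 / 2 + v\<^sup>2 / 2)) = \<epsilon>\<^sup>2 * ln (4 * pi) + ((\<epsilon> * u)\<^sup>2 + (\<epsilon> * v)\<^sup>2) / 2"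
      for u v :: real
      by (subst ln_mult_pos) (auto simp: power_mult_distrib algebra_simps add_divide_distrib)
    moreover have "\<epsilon> * (x / \<epsilon> + 1) = x + \<epsilon>" for x
      using that by (simp add: distrib_left)
    ultimately have "\<epsilon>\<^sup>2 * ln r = g \<epsilon>" by (simp only: g_def r)
    moreover have "ereal (\<epsilon>\<^sup>2) * ln_ennreal (mean_exit_time M (proc (\<lambda>x. a * x\<^sup>2) \<epsilon> \<xi>))
        \<le> ereal (\<epsilon>\<^sup>2) * ereal (ln r)"
      using mean_exit_time_le[OF ind dist \<open>a \<ge> 0\<close> that a(2-4)]
      by (intro ereal_mult_left_mono ln_ennreal_le) (auto simp: r_def normal_density_pos)
    ultimately show ?thesis by simp
  qed
  then have "Limsup (at_right 0)
      (\<lambda>\<epsilon>. ereal (\<epsilon>\<^sup>2) * ln_ennreal (mean_exit_time M (proc (\<lambda>x. a * x\<^sup>2) \<epsilon> \<xi>)))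
      \<le> Limsup (at_right 0) (\<lambda>\<epsilon>. ereal (g \<epsilon>))"
    by (intro Limsup_mono) (auto simp: eventually_at_filter)
  also have "(g \<longlongrightarrow> 0\<^sup>2 * ln (4 * pi) + ((c + 0)\<^sup>2 + (d + 0)\<^sup>2) / 2) (at_right 0)"
    unfolding g_def by (intro tendsto_intros) auto
  then have "Limsup (at_right 0) (\<lambda>\<epsilon>. ereal (g \<epsilon>)) = ereal ((c\<^sup>2 + d\<^sup>2) / 2)"
    by (intro lim_imp_Limsup) auto
  finally show ?thesis .
qed

theorem mainTheorem9:
  fixes M :: "'w measure" and \<xi> :: "nat \<Rightarrow> 'w \<Rightarrow> real" and a :: real
  assumes "prob_space M"
    and "prob_space.indep_vars M (\<lambda>_. borel) \<xi> {1..}"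
    and "\<And>n. n \<ge> 1 \<Longrightarrow> distributed M lborel (\<xi> n) std_normal_density"
    and "a \<ge> 0"
  shows "(a \<le> 1/2 \<longrightarrow>
           Limsup (at_right (0::real))
             (\<lambda>\<epsilon>. ereal (\<epsilon>\<^sup>2) * ln_ennreal (mean_exit_time M (proc (\<lambda>x. a * x\<^sup>2) \<epsilon> \<xi>)))
           \<le> ereal (1/2))
       \<and> (a \<ge> 1/2 \<longrightarrow>
           Limsup (at_right (0::real))
             (\<lambda>\<epsilon>. ereal (\<epsilon>\<^sup>2) * ln_ennreal (mean_exit_time M (proc (\<lambda>x. a * x\<^sup>2) \<epsilon> \<xi>)))
           \<le> ereal (1/2 * (1/a - 1 / (4 * a\<^sup>2))))"
proof -
  interpret prob_space M by fact
  have bound: "Limsup (at_right 0)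
      (\<lambda>\<epsilon>. ereal (\<epsilon>\<^sup>2) * ln_ennreal (mean_exit_time M (proc (\<lambda>x. a * x\<^sup>2) \<epsilon> \<xi>)))
      \<le> ereal ((c\<^sup>2 + d\<^sup>2) / 2)" if "c \<ge> 0" "d \<ge> 0" "a * c\<^sup>2 + d \<ge> 1" for c d
    using assms(2-4) that by (rule Limsup_ln_mean_exit_time_le)
  have "Limsup (at_right 0)
      (\<lambda>\<epsilon>. ereal (\<epsilon>\<^sup>2) * ln_ennreal (mean_exit_time M (proc (\<lambda>x. a * x\<^sup>2) \<epsilon> \<xi>)))
      \<le> ereal (1/2 * (1/a - 1 / (4 * a\<^sup>2)))" if "a \<ge> 1/2"
  proof -
    \<comment> \<open>On the constraint \<open>a * c\<^sup>2 + d = 1\<close> the cost is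
      \<open>(1 - d) / a + d\<^sup>2\<close>, minimal at \<open>d = 1 / (2 * a)\<close>; then
      \<open>c\<^sup>2 = (1 - d) / a\<close>, which is nonnegative because
      \<open>a \<ge> 1/2\<close> gives \<open>d \<le> 1\<close>.\<close>
    define c where "c = sqrt (1 / a - 1 / (2 * a\<^sup>2))"
    have "1 / a - 1 / (2 * a\<^sup>2) \<ge> 0"
      using that by (simp add: field_simps power2_eq_square)
    then have c: "c \<ge> 0" "c\<^sup>2 = 1 / a - 1 / (2 * a\<^sup>2)" by (auto simp: c_def)
    have "a * c\<^sup>2 + 1 / (2 * a) = 1"
      unfolding c using that by (simp add: field_simps power2_eq_square)
    then have "Limsup (at_right 0)
        (\<lambda>\<epsilon>. ereal (\<epsilon>\<^sup>2) * ln_ennreal (mean_exit_time M (proc (\<lambda>x. a * x\<^sup>2) \<epsilon> \<xi>)))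
        \<le> ereal ((c\<^sup>2 + (1 / (2 * a))\<^sup>2) / 2)"
      using \<open>a \<ge> 0\<close> c(1) by (intro bound) auto
    also have "(c\<^sup>2 + (1 / (2 * a))\<^sup>2) / 2 = 1/2 * (1/a - 1 / (4 * a\<^sup>2))"
      unfolding c using that by (simp add: field_simps power2_eq_square)
    finally show ?thesis .
  qed
  \<comment> \<open>With \<open>c = 0\<close> and \<open>d = 1\<close> the second noise term alone
    reaches the level 1; the first need only be nonnegative, which has a probability independent of
    \<open>\<epsilon>\<close>.\<close>
  moreover have "Limsup (at_right 0)
      (\<lambda>\<epsilon>. ereal (\<epsilon>\<^sup>2) * ln_ennreal (mean_exit_time M (proc (\<lambda>x. a * x\<^sup>2) \<epsilon> \<xi>))) \<le> ereal (1/2)"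
    using bound[of 0 1] by simp
  ultimately show ?thesis by blast
qed

end
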